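(* Suppose that for each bidder $l\in L$ the amounts offered are equally spaced by $m$ and the true costs are marginally increasing, i.e. whenever $x_{l,a},x_{l,b},x_{l,c},x_{l,d}$ are among bidder $l$'s amounts with $0\le x_{l,a}<x_{l,c}<x_{l,d}$, the equality $x_{l,b}-x_{l,a}=x_{l,d}-x_{l,c}$ implies $c_{l,b}-c_{l,a}<c_{l,d}-c_{l,c}$. Then the objective function $S\mapsto J(\mathcal{C}_S)$, $S\subseteq L$, is supermodular.
   Context: Single-good reverse auction. $L$ is a finite set of bidders; the operator must procure an amount $M$ of a single type of good; $m>0$ is an increment such that $M$ is an integer multiple of $m$. Bidder $l$ submits mutually exclusive (truthful) bids $\{(c_{l,i},x_{l,i})\}_{i=1}^{n_l}$ with $c_{l,i}\in\mathbb{R}_+$ nondecreasing in $i$ and $x_{l,i}=im$ for $i=1,\dots,n_l$; by convention $x_{l,0}=0$ and $c_{l,0}=0$, and $(c_{l,0},x_{l,0})$ also counts among the bidder's amounts. The associated cost function is $c_l(0)=0$ and, for $x>0$, $$c_l(x)=\min_{i=1,\dots,n_l}\{c_{l,i}\mid x_{l,i}\ge x\},$$ with the minimum over the empty set equal to $+\infty$. For $S\subseteq L$, $$J(\mathcal{C}_S)=\min_{x\in\mathbb{R}_+^{|S|}}\ \sum_{l\in S}c_l(x_l)\quad\text{s.t. }\sum_{l\in S}x_l\ge M,$$ with value $+\infty$ if the problem is infeasible. A function $f:2^L\to\mathbb{R}\cup\{+\infty\}$ is supermodular if $f(S\cup R)+f(S\cap R)\ge f(S)+f(R)$ for all $S,R\subseteq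 L$ (for finite-valued $f$ this is equivalent to $f(S)-f(S\setminus\{l\})\le f(R)-f(R\setminus\{l\})$ for all $S\subseteq R\subseteq L$, $l\in S$). *)

theory Defs
  imports Complex_Main "HOL-Library.Extended_Real" "HOL-Library.FuncSet"
begin

text \<open>A bidder is given by the number n of its bids and by the costs c i and amounts x i
  of these bids, i = 1, ..., n; index 0 stands for the empty bid.
  Infima are taken in \<^typ>\<open>ereal\<close>, where the infimum of the empty set is \<^term>\<open>\<infinity>::ereal\<close>.\<close>

definition bid_cost :: "nat \<Rightarrow> (nat \<Rightarrow> real) \<Rightarrow> (nat \<Rightarrow> real) \<Rightarrow> real \<Rightarrow> ereal" where
  "bid_cost n c x y = (if y = 0 then 0 else (INF i\<in>{i\<in>{1..n}. y \<le> x i}. ereal (c i)))"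

lemma bid_cost_eq_Min:
  assumes "y \<noteq> 0" "{i\<in>{1..n}. y \<le> x i} \<noteq> {}"
  shows "bid_cost n c x y = Min ((\<lambda>i. ereal (c i)) ` {i\<in>{1..n}. y \<le> x i})"
  using assms unfolding bid_cost_def by (subst Min_Inf) auto

text \<open>The procurement problem always has an optimal solution when its constraints can be met:
  rounding each allocation up to an offered amount does not change the cost, which leaves finitely
  many candidates of finite cost. Hence the infimum below is a minimum in that case.\<close>

definition procurement_value ::
  "real \<Rightarrow> ('b \<Rightarrow> nat) \<Rightarrow> ('b \<Rightarrow> nat \<Rightarrow> real) \<Rightarrow> ('b \<Rightarrow> nat \<Rightarrow> real) \<Rightarrow> 'b set \<Rightarrow> ereal" where
  "procurement_value M n c x S =
     (INF y\<in>{y \<in> S \<rightarrow>\<^sub>E {0..}. (\<Sum>l\<in>S. y l) \<ge> M}. \<Sum>l\<in>S. bid_cost (n l) (c l) (x l) (y l))"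

definition marginally_increasing :: "nat \<Rightarrow> (nat \<Rightarrow> real) \<Rightarrow> (nat \<Rightarrow> real) \<Rightarrow> bool" where
  "marginally_increasing n c x \<longleftrightarrow>
     (\<forall>i\<in>{0..n}. \<forall>j\<in>{0..n}. \<forall>k\<in>{0..n}. \<forall>h\<in>{0..n}.
        0 \<le> x i \<and> x i < x k \<and> x k < x h \<and> x j - x i = x h - x k \<longrightarrow> c j - c i < c h - c k)"

text \<open>The first conjunct restricts the values of f to the reals and \<^term>\<open>\<infinity>::ereal\<close>.\<close>

definition supermodular_on :: "'b set \<Rightarrow> ('b set \<Rightarrow> ereal) \<Rightarrow> bool" where
  "supermodular_on L f \<longleftrightarrow>
     (\<forall>S\<subseteq>L. f S \<noteq> - \<infinity>) \<and>
     (\<forall>S\<subseteq>L. \<forall>R\<subseteq>L. f (S \<union> R) + f (S \<inter> R) \<ge> f S + f R)"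

end

theory Submission
  imports Defs
begin

text \<open>
  Only selections of bids matter, since every allocation of finite cost is covered by one of the
  same cost. Take optimal selections q for S \<union> R and p for S \<inter> R. On S \<inter> R the two
  amounts of each bidder can be moved towards each other, keeping their sum, into amounts u and v;
  by increasing marginal costs this does not raise the total cost. A discrete intermediate value
  argument picks u such that u together with q on S - R, and v together with q on R - S, both
  procure M.
\<close>

lemma bid_cost_offered_le:
  assumes "i \<le> n" "c 0 = 0" "x 0 = 0" "\<And>i. i \<in> {1..n} \<Longrightarrow> 0 \<le> c i"
  shows "bid_cost n c x (x i) \<le> ereal (c i)"
proof (cases "i = 0")
  case True
  then show ?thesis using assms by (simp add: bid_cost_def)
next
  case False
  then have "i \<in> {i' \<in> {1..n}. x i \<le> x i'}" using assms(1) by auto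
  \<comment> \<open>A nonempty bid with \<open>x i = 0\<close> is possible here; its cost is then 0,
    and nonnegativity of \<open>c i\<close> gives the bound.\<close>
  then show ?thesis using assms(4) by (auto simp: bid_cost_def intro: INF_lower)
qed

text \<open>A finite cost at \<open>y \<noteq> 0\<close> is an infimum over a finite nonempty set,
  hence attained. At \<open>y = 0\<close> the empty bid serves as the witness.\<close>

lemma bid_cost_eq_offered:
  assumes "bid_cost n c x y \<noteq> \<infinity>" "c 0 = 0" "x 0 = 0"
  obtains i where "i \<le> n" "y \<le> x i" "bid_cost n c x y = ereal (c i)"
proof (cases "y = 0")
  case True
  then show ?thesis using assms that[of 0] by (simp add: bid_cost_def zero_ereal_def)
next
  case False
  let ?I = "{i \<in> {1..n}. y \<le> x i}"
  have ne: "?I \<noteq> {}"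
  proof
    assume "?I = {}"
    with False have "bid_cost n c x y = \<infinity>"
      unfolding bid_cost_def by (simp add: top_ereal_def del: Collect_empty_eq)
    with assms(1) show False ..
  qed
  then have "bid_cost n c x y \<in> (\<lambda>i. ereal (c i)) ` ?I"
    unfolding bid_cost_eq_Min[OF False ne] by (intro Min_in) auto
  then show ?thesis using that by auto
qed

lemma bid_cost_nonneg:
  assumes "\<And>i. i \<in> {1..n} \<Longrightarrow> 0 \<le> c i"
  shows "0 \<le> bid_cost n c x y"
  using assms by (auto simp: bid_cost_def intro!: INF_greatest)

text \<open>A selection names one bid index per bidder, with 0 for the empty bid. Fixing the values
  outside \<open>S\<close> by the extensional product keeps the set finite.\<close>

definition bid_selections ::
  "real \<Rightarrow> ('b \<Rightarrow> nat) \<Rightarrow> ('b \<Rightarrow> nat \<Rightarrow> real) \<Rightarrow> 'b set \<Rightarrow> ('b \<Rightarrow> nat) set" where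
  "bid_selections M n x S = {q \<in> (\<Pi>\<^sub>E l\<in>S. {0..n l}). M \<le> (\<Sum>l\<in>S. x l (q l))}"

text \<open>Replaces a continuous problem by a finite one. A selection gives the allocation of its
  own amounts at no greater cost; conversely, each component of an allocation of finite cost is
  rounded up to an offered amount of the same cost.\<close>

lemma procurement_value_eq_INF_selections:
  assumes "finite S"
    and c0: "\<And>l. l \<in> S \<Longrightarrow> c l 0 = 0" and x0: "\<And>l. l \<in> S \<Longrightarrow> x l 0 = 0"
    and c_nonneg: "\<And>l i. l \<in> S \<Longrightarrow> i \<in> {1..n l} \<Longrightarrow> 0 \<le> c l i"
    and x_nonneg: "\<And>l i. l \<in> S \<Longrightarrow> i \<in> {1..n l} \<Longrightarrow> 0 \<le> x l i"
  shows "procurement_value M n c x S =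
    (INF q\<in>bid_selections M n x S. ereal (\<Sum>l\<in>S. c l (q l)))"
  unfolding procurement_value_def
proof (intro antisym INF_greatest)
  fix q assume q: "q \<in> bid_selections M n x S"
  let ?y = "restrict (\<lambda>l. x l (q l)) S"
  have q_le: "q l \<le> n l" if "l \<in> S" for l
    using q that by (auto simp: bid_selections_def PiE_iff)
  have "0 \<le> x l (q l)" if "l \<in> S" for l
    using x_nonneg[OF that, of "q l"] x0[OF that] q_le[OF that] by (cases "q l = 0") auto
  then have y: "?y \<in> {y \<in> S \<rightarrow>\<^sub>E {0..}. M \<le> (\<Sum>l\<in>S. y l)}"
    using q by (auto simp: bid_selections_def)
  have "(\<Sum>l\<in>S. bid_cost (n l) (c l) (x l) (?y l)) \<le> (\<Sum>l\<in>S. ereal (c l (q l)))"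
    using q_le c0 x0 c_nonneg by (intro sum_mono) (auto intro: bid_cost_offered_le)
  also have "\<dots> = ereal (\<Sum>l\<in>S. c l (q l))" by simp
  finally show "(INF y\<in>{y \<in> S \<rightarrow>\<^sub>E {0..}. M \<le> (\<Sum>l\<in>S. y l)}.
      \<Sum>l\<in>S. bid_cost (n l) (c l) (x l) (y l)) \<le> ereal (\<Sum>l\<in>S. c l (q l))"
    by (rule INF_lower2[OF y])
next
  fix y assume y: "y \<in> {y \<in> S \<rightarrow>\<^sub>E {0..}. M \<le> (\<Sum>l\<in>S. y l)}"
  show "(INF q\<in>bid_selections M n x S. ereal (\<Sum>l\<in>S. c l (q l)))
      \<le> (\<Sum>l\<in>S. bid_cost (n l) (c l) (x l) (y l))"
  proof (cases "\<exists>l\<in>S. bid_cost (n l) (c l) (x l) (y l) = \<infinity>")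
    case True
    then have "(\<Sum>l\<in>S. bid_cost (n l) (c l) (x l) (y l)) = \<infinity>"
      using \<open>finite S\<close> by (simp add: sum_Pinfty)
    then show ?thesis by simp
  next
    case False
    then have "\<forall>l\<in>S. \<exists>i. i \<le> n l \<and> y l \<le> x l i
        \<and> bid_cost (n l) (c l) (x l) (y l) = ereal (c l i)"
      using c0 x0 by (meson bid_cost_eq_offered)
    then obtain q where q: "\<And>l. l \<in> S \<Longrightarrow> q l \<le> n l \<and> y l \<le> x l (q l)
        \<and> bid_cost (n l) (c l) (x l) (y l) = ereal (c l (q l))"
      by metis
    have "M \<le> (\<Sum>l\<in>S. y l)" using y by simp
    also have "\<dots> \<le> (\<Sum>l\<in>S. x l (q l))" using q by (intro sum_mono) auto
    finally have "restrict q S \<in> bid_selections M n x S"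
      using q by (auto simp: bid_selections_def)
    then show ?thesis by (rule INF_lower2) (use q in simp)
  qed
qed

lemma finite_bid_selections: "finite S \<Longrightarrow> finite (bid_selections M n x S)"
  unfolding bid_selections_def
  by (rule finite_subset[OF _ finite_PiE[of S "\<lambda>l. {0..n l}"]]) auto

text \<open>Discrete intermediate value property of sums over an integer box, by induction on the
  index set.\<close>

lemma exists_bounded_sum_eq:
  fixes lo hi :: "'a \<Rightarrow> nat"
  assumes "finite C" "\<And>l. l \<in> C \<Longrightarrow> lo l \<le> hi l"
    and "(\<Sum>l\<in>C. lo l) \<le> t" "t \<le> (\<Sum>l\<in>C. hi l)"
  shows "\<exists>u. (\<forall>l\<in>C. lo l \<le> u l \<and> u l \<le> hi l) \<and> (\<Sum>l\<in>C. u l) = t"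
  using assms
proof (induction C arbitrary: t rule: finite_induct)
  case empty
  then show ?case by simp
next
  case (insert a C)
  \<comment> \<open>The share left to \<open>C\<close> is the least one that respects its lower
    bounds and leaves at most \<open>hi a\<close> to \<open>a\<close>. Truncated subtraction gives 0
    when \<open>hi a\<close> already exceeds \<open>t\<close>.\<close>
  define s where "s = max (\<Sum>l\<in>C. lo l) (t - hi a)"
  have le: "(\<Sum>l\<in>C. lo l) \<le> (\<Sum>l\<in>C. hi l)" using insert.prems(1) by (intro sum_mono) auto
  have "lo a \<le> hi a" using insert.prems(1) by simp
  then have s: "(\<Sum>l\<in>C. lo l) \<le> s" "s \<le> (\<Sum>l\<in>C. hi l)" "lo a \<le> t - s" "t - s \<le> hi a" "s \<le> t"
    using insert.hyps insert.prems(2,3) le by (auto simp: s_def)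
  then obtain u where u: "\<forall>l\<in>C. lo l \<le> u l \<and> u l \<le> hi l" "(\<Sum>l\<in>C. u l) = s"
    using insert.IH[of s] insert.prems(1) by auto
  have "(\<Sum>l\<in>C. (u(a := t - s)) l) = (\<Sum>l\<in>C. u l)"
    using insert.hyps(2) by (intro sum.cong) auto
  then show ?case
    using u s insert.hyps by (intro exI[of _ "u(a := t - s)"]) auto
qed

text \<open>Discrete convexity: moving two indices towards each other with fixed sum cannot raise
  the total cost. Equality occurs when \<open>u\<close> is an endpoint, hence the weak
  inequality.\<close>

lemma marginally_increasing_exchange:
  assumes mi: "marginally_increasing n c x" and x: "\<And>i. i \<le> n \<Longrightarrow> x i = real i * m" and "m > 0"
    and le: "q \<le> n" "p \<le> n" and u: "min q p \<le> u" "u \<le> max q p" and sum: "u + v = q + p"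
  shows "c u + c v \<le> c q + c p"
proof -
  have *: "c u + c v \<le> c a + c b" if "a \<le> u" "u \<le> b" "b \<le> n" "u + v = a + b" for a b
  proof (cases "u = a \<or> u = b")
    case True
    then show ?thesis using that by auto
  next
    case False
    with that have lt: "a < u" "u < b" by auto
    have bounds: "a \<le> n" "u \<le> n" "v \<le> n" using that lt by auto
    \<comment> \<open>The steps from \<open>a\<close> to \<open>v\<close> and from \<open>u\<close>
      to \<open>b\<close> have equal length and the second starts later, so the strict hypothesis
      applies to the indices \<open>a\<close>, \<open>v\<close>, \<open>u\<close>,
      \<open>b\<close>.\<close>
    have "real v - real a = real b - real u" using that(4) by linarith
    then have "x v - x a = x b - x u"
      using bounds that(3) x by (metis left_diff_distrib)
    moreover have "0 \<le> x a" "x a < x u" "x u < x b"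
      using bounds that(3) lt x \<open>m > 0\<close> by auto
    ultimately have "c v - c a < c b - c u"
      using mi bounds that(3) unfolding marginally_increasing_def by auto
    then show ?thesis by linarith
  qed
  show ?thesis
    using *[of q p] *[of p q] u le sum by (cases "q \<le> p") (auto simp: min_def max_def add.commute)
qed

theorem theorem4:
  fixes L :: "'b set" and m M :: real
    and n :: "'b \<Rightarrow> nat" and c x :: "'b \<Rightarrow> nat \<Rightarrow> real"
  assumes "finite L"
    and "m > 0" and "\<exists>k::int. M = of_int k * m"
    and "\<And>l. l \<in> L \<Longrightarrow> c l 0 = 0" and "\<And>l. l \<in> L \<Longrightarrow> x l 0 = 0"
    and "\<And>l i. l \<in> L \<Longrightarrow> i \<in> {1..n l} \<Longrightarrow> c l i \<ge> 0"
    and "\<And>l. l \<in> L \<Longrightarrow> mono_on {1..n l} (c l)"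
    and "\<And>l i. l \<in> L \<Longrightarrow> i \<in> {1..n l} \<Longrightarrow> x l i = real i * m"
    and "\<And>l. l \<in> L \<Longrightarrow> marginally_increasing (n l) (c l) (x l)"
  shows "supermodular_on L (procurement_value M n c x)"
proof -
  obtain k :: int where k: "M = of_int k * m" using assms(3) by blast
  have x_eq: "x l i = real i * m" if "l \<in> L" "i \<le> n l" for l i
    using assms(5,8) that by (cases "i = 0") auto
  have value_eq: "procurement_value M n c x S =
      (INF q\<in>bid_selections M n x S. ereal (\<Sum>l\<in>S. c l (q l)))" if "S \<subseteq> L" for S
    using that assms(1,2,4-6,8)
    by (intro procurement_value_eq_INF_selections) (auto intro: finite_subset simp: subset_iff)
  \<comment> \<open>Dividing by \<open>m\<close> turns the demand constraint into an integer one,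
    which the discrete intermediate value argument needs. Since \<open>k\<close> may be negative,
    sums of indices are cast to \<open>int\<close>.\<close>
  have selections_iff: "q \<in> bid_selections M n x S \<longleftrightarrow>
      q \<in> (\<Pi>\<^sub>E l\<in>S. {0..n l}) \<and> k \<le> int (\<Sum>l\<in>S. q l)" if "S \<subseteq> L" for S q
  proof -
    have "(\<Sum>l\<in>S. x l (q l)) = of_int (int (\<Sum>l\<in>S. q l)) * m" if "q \<in> (\<Pi>\<^sub>E l\<in>S. {0..n l})"
    proof -
      have "(\<Sum>l\<in>S. x l (q l)) = (\<Sum>l\<in>S. real (q l) * m)"
        using that \<open>S \<subseteq> L\<close> by (intro sum.cong) (auto simp: PiE_iff intro!: x_eq)
      then show ?thesis by (simp add: sum_distrib_right)
    qed
    moreover have "M \<le> of_int j * m \<longleftrightarrow> k \<le> j" for j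
      unfolding k using assms(2) by simp
    ultimately show ?thesis
      unfolding bid_selections_def by (auto simp del: of_nat_sum of_int_of_nat_eq)
  qed
  have value_le: "procurement_value M n c x S \<le> ereal (\<Sum>l\<in>S. c l (q l))"
    if "S \<subseteq> L" "\<And>l. l \<in> S \<Longrightarrow> q l \<le> n l" "k \<le> int (\<Sum>l\<in>S. q l)" for S q
  proof -
    have "restrict q S \<in> bid_selections M n x S"
      unfolding selections_iff[OF that(1)] using that(2,3) by auto
    then show ?thesis unfolding value_eq[OF that(1)] by (rule INF_lower2) simp
  qed
  \<comment> \<open>A finite value means that some selection exists, and a minimum over finitely
    many selections is attained.\<close>
  have value_attained: "\<exists>q. (\<forall>l\<in>S. q l \<le> n l) \<and> k \<le> int (\<Sum>l\<in>S. q l)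
      \<and> procurement_value M n c x S = ereal (\<Sum>l\<in>S. c l (q l))"
    if "S \<subseteq> L" "procurement_value M n c x S \<noteq> \<infinity>" for S
  proof -
    let ?g = "\<lambda>q. ereal (\<Sum>l\<in>S. c l (q l))"
    have ne: "bid_selections M n x S \<noteq> {}"
    proof
      assume "bid_selections M n x S = {}"
      then show False using that(2) unfolding value_eq[OF that(1)] by (simp add: top_ereal_def)
    qed
    have "finite (bid_selections M n x S)"
      using that(1) assms(1) by (intro finite_bid_selections) (rule finite_subset)
    then have "Inf (?g ` bid_selections M n x S) \<in> ?g ` bid_selections M n x S"
      using ne by (subst Min_Inf[symmetric]) (auto intro!: Min_in simp del: sum_ereal)
    then obtain q where q: "q \<in> bid_selections M n x S" "procurement_value M n c x S = ?g q"
      unfolding value_eq[OF \<open>S \<subseteq> L\<close>] by blast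
    then show ?thesis
      unfolding selections_iff[OF that(1)] by (intro exI[of _ q]) (auto simp: PiE_iff)
  qed
  have value_nonneg: "0 \<le> procurement_value M n c x S" if "S \<subseteq> L" for S
    unfolding procurement_value_def
    using that assms(6) by (intro INF_greatest sum_nonneg bid_cost_nonneg) auto
  have "procurement_value M n c x S + procurement_value M n c x R
      \<le> procurement_value M n c x (S \<union> R) + procurement_value M n c x (S \<inter> R)"
    if S: "S \<subseteq> L" and R: "R \<subseteq> L" for S R
  proof (cases "procurement_value M n c x (S \<union> R) = \<infinity> \<or> procurement_value M n c x (S \<inter> R) = \<infinity>")
    case True
    then show ?thesis by auto
  next
    case False
    let ?A = "S - R" and ?B = "R - S" and ?C = "S \<inter> R"
    have fin: "finite S" "finite R" using S R assms(1) finite_subset by auto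
    \<comment> \<open>Polymorphic in the summands, since the splitting serves both amounts in
      \<open>nat\<close> and costs in \<open>real\<close>.\<close>
    have sum_S: "sum f S = sum f ?A + sum f ?C" and sum_R: "sum f R = sum f ?B + sum f ?C"
      and sum_Un: "sum f (S \<union> R) = sum f ?A + sum f ?B + sum f ?C"
      for f :: "'b \<Rightarrow> 'c :: comm_monoid_add"
    proof -
      have "sum f (?A \<union> ?C) = sum f ?A + sum f ?C" "sum f (?B \<union> ?C) = sum f ?B + sum f ?C"
        "sum f ((?A \<union> ?B) \<union> ?C) = sum f (?A \<union> ?B) + sum f ?C"
        "sum f (?A \<union> ?B) = sum f ?A + sum f ?B"
        using fin by (intro sum.union_disjoint; auto)+
      moreover have "?A \<union> ?C = S" "?B \<union> ?C = R" "(?A \<union> ?B) \<union> ?C = S \<union> R" by auto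
      ultimately show "sum f S = sum f ?A + sum f ?C" "sum f R = sum f ?B + sum f ?C"
        "sum f (S \<union> R) = sum f ?A + sum f ?B + sum f ?C" by simp_all
    qed
    obtain q where q: "\<forall>l\<in>S \<union> R. q l \<le> n l" "k \<le> int (\<Sum>l\<in>S \<union> R. q l)"
      and q_opt: "procurement_value M n c x (S \<union> R) = ereal (\<Sum>l\<in>S \<union> R. c l (q l))"
      using value_attained[of "S \<union> R"] False S R by auto
    obtain p where p: "\<forall>l\<in>?C. p l \<le> n l" "k \<le> int (\<Sum>l\<in>?C. p l)"
      and p_opt: "procurement_value M n c x ?C = ereal (\<Sum>l\<in>?C. c l (p l))"
      using value_attained[of ?C] False S by auto
    let ?lo = "\<lambda>l. min (q l) (p l)" and ?hi = "\<lambda>l. max (q l) (p l)"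
    have lo_hi: "(\<Sum>l\<in>?C. ?lo l) + (\<Sum>l\<in>?C. ?hi l) = (\<Sum>l\<in>?C. q l) + (\<Sum>l\<in>?C. p l)"
      unfolding sum.distrib[symmetric] by (intro sum.cong) auto
    have lo_le_hi: "(\<Sum>l\<in>?C. ?lo l) \<le> (\<Sum>l\<in>?C. ?hi l)" by (intro sum_mono) auto
    have le_hi: "(\<Sum>l\<in>?C. p l) \<le> (\<Sum>l\<in>?C. ?hi l)" by (intro sum_mono) auto
    have q_sum: "k \<le> int (\<Sum>l\<in>?A. q l) + int (\<Sum>l\<in>?B. q l) + int (\<Sum>l\<in>?C. q l)"
      using q(2) unfolding sum_Un by simp
    \<comment> \<open>Here \<open>t\<close> is the amount on \<open>S \<inter> R\<close> given to
      \<open>S\<close>, and \<open>R\<close> receives the rest of the common total; the last two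
      inequalities say that both sides meet the demand.\<close>
    have split_sum: "\<exists>t. lo \<le> t \<and> t \<le> hi \<and> k \<le> int a + int t \<and> k + int t \<le> int b + int q\<^sub>C + int p\<^sub>C"
      if "lo + hi = q\<^sub>C + p\<^sub>C" "lo \<le> hi" "p\<^sub>C \<le> hi"
        "k \<le> int a + int b + int q\<^sub>C" "k \<le> int p\<^sub>C"
      for lo hi a b q\<^sub>C p\<^sub>C :: nat
      \<comment> \<open>The least \<open>t\<close> that suffices for \<open>S\<close>. If it is
        \<open>lo\<close>, then \<open>R\<close> is served because \<open>k \<le> hi\<close>; if it
        is \<open>k - a\<close>, adding the two demand constraints gives the claim.\<close>
      using that by (intro exI[of _ "max lo (nat (k - int a))"]) auto
    obtain t where t: "(\<Sum>l\<in>?C. ?lo l) \<le> t" "t \<le> (\<Sum>l\<in>?C. ?hi l)" "k \<le> int (\<Sum>l\<in>?A. q l) + int t"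
      and t': "k + int t \<le> int (\<Sum>l\<in>?B. q l) + int (\<Sum>l\<in>?C. q l) + int (\<Sum>l\<in>?C. p l)"
      using split_sum[OF lo_hi lo_le_hi le_hi q_sum p(2)] by blast
    obtain u where u: "\<forall>l\<in>?C. ?lo l \<le> u l \<and> u l \<le> ?hi l" "(\<Sum>l\<in>?C. u l) = t"
      using exists_bounded_sum_eq[OF finite_Int[OF disjI1[OF fin(1)]] _ t(1,2)]
      by (auto simp: min_le_iff_disj le_max_iff_disj)
    \<comment> \<open>The subtraction does not truncate on \<open>S \<inter> R\<close>, as
      \<open>u l\<close> is at most \<open>max (q l) (p l)\<close>.\<close>
    define v where "v l = q l + p l - u l" for l
    have uv: "u l + v l = q l + p l" "u l \<le> n l" "v l \<le> n l" if "l \<in> ?C" for l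
    proof -
      have "?lo l \<le> u l" "u l \<le> ?hi l" "q l \<le> n l" "p l \<le> n l" using u(1) q(1) p(1) that by auto
      then show "u l + v l = q l + p l" "u l \<le> n l" "v l \<le> n l" unfolding v_def by auto
    qed
    have v_sum: "t + (\<Sum>l\<in>?C. v l) = (\<Sum>l\<in>?C. q l) + (\<Sum>l\<in>?C. p l)"
      unfolding u(2)[symmetric] sum.distrib[symmetric] using uv(1) by (intro sum.cong) auto
    have v_ge: "k \<le> int (\<Sum>l\<in>?B. q l) + int (\<Sum>l\<in>?C. v l)"
      using t' v_sum by linarith
    \<comment> \<open>Feasible, generally not optimal, selections for \<open>S\<close> and
      \<open>R\<close>: the rebalanced indices on the intersection and those of \<open>q\<close>
      elsewhere.\<close>
    let ?u = "\<lambda>l. if l \<in> R then u l else q l" and ?v = "\<lambda>l. if l \<in> S then v l else q l"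
    have "procurement_value M n c x S \<le> ereal (\<Sum>l\<in>S. c l (?u l))"
      using S q(1) uv t(3) u(2) by (intro value_le) (auto simp: sum_S)
    moreover have "procurement_value M n c x R \<le> ereal (\<Sum>l\<in>R. c l (?v l))"
      using R q(1) uv v_ge by (intro value_le) (auto simp: sum_R)
    ultimately have "procurement_value M n c x S + procurement_value M n c x R
        \<le> ereal ((\<Sum>l\<in>S. c l (?u l)) + (\<Sum>l\<in>R. c l (?v l)))"
      by (metis add_mono plus_ereal.simps(1))
    also have "(\<Sum>l\<in>S. c l (?u l)) + (\<Sum>l\<in>R. c l (?v l))
        = (\<Sum>l\<in>?A. c l (q l)) + (\<Sum>l\<in>?B. c l (q l)) + (\<Sum>l\<in>?C. c l (u l) + c l (v l))"
      unfolding sum_S sum_R by (simp add: sum.distrib)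
    also have "(\<Sum>l\<in>?C. c l (u l) + c l (v l)) \<le> (\<Sum>l\<in>?C. c l (q l) + c l (p l))"
    proof (intro sum_mono)
      fix l assume l: "l \<in> ?C"
      then have "l \<in> L" using S by auto
      then show "c l (u l) + c l (v l) \<le> c l (q l) + c l (p l)"
        using l u(1) uv(1)[OF l] q(1) p(1) x_eq
        by (intro marginally_increasing_exchange[OF assms(9) _ \<open>m > 0\<close>]) auto
    qed
    \<comment> \<open>Regrouping: all terms in \<open>q\<close> form the optimal cost for
      \<open>S \<union> R\<close>, and those in \<open>p\<close> the one for
      \<open>S \<inter> R\<close>.\<close>
    also have "(\<Sum>l\<in>?A. c l (q l)) + (\<Sum>l\<in>?B. c l (q l)) + (\<Sum>l\<in>?C. c l (q l) + c l (p l))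
        = (\<Sum>l\<in>S \<union> R. c l (q l)) + (\<Sum>l\<in>?C. c l (p l))"
      unfolding sum_Un by (simp add: sum.distrib)
    finally show ?thesis unfolding q_opt p_opt by simp
  qed
  moreover have "procurement_value M n c x S \<noteq> - \<infinity>" if "S \<subseteq> L" for S
    using value_nonneg[OF that] by auto
  ultimately show ?thesis unfolding supermodular_on_def by blast
qed

end
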